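(* For all integers $n\ge 1$ and $0\le a\le n$, $$\tilde{V}(a,n)\ \leq\ \max\left(\frac{a}{n},\frac12\right)+\min\left(\frac14\sqrt{\frac{\pi}{n}},\ \frac{1}{2\cdot\left|2a-n\right|}\right),$$ where, if $2a=n$, the term $\frac{1}{2|2a-n|}$ is interpreted as $+\infty$.
   Context: The Chow–Robbins game: a fair coin is tossed repeatedly (independent tosses, each heads with probability $1/2$), and the player may stop at any time, receiving as payoff the proportion of heads among all tosses so far. A position $(a,n)$ means that $a$ heads have occurred in the first $n$ coin flips. $\tilde{V}(a,n)$ denotes the expected payoff from position $(a,n)$ under infinite clairvoyance, that is, assuming the player has complete knowledge of the results of all future coin flips and stops when the maximum proportion of heads (over the present and all future times) is reached. Explicitly, $$\tilde V(a,n)=\mathbb{E}\left[\sup_{m\ge 0}\frac{a+S_m}{n+m}\right],$$ where $S_m=X_1+\dots+X_m$ ($S_0=0$) and $X_1,X_2,\dots$ are i.i.d. with $\Pr(X_i=1)=\Pr(X_i=0)=1/2$ ($1$ = heads). *)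

theory Defs
  imports "HOL-Probability.Probability"
begin

text \<open>
  The tosses are indexed from 0 and are Boolean-valued (True is heads), so that the
  head counts are bounded everywhere and not only almost everywhere.
\<close>

locale fair_coin_tosses = prob_space M
  for M :: "'w measure" and X :: "nat \<Rightarrow> 'w \<Rightarrow> bool" +
  assumes indep: "indep_vars (\<lambda>_. count_space UNIV) X UNIV"
    and fair: "\<And>i. prob {w \<in> space M. X i w} = 1 / 2"

definition heads :: "(nat \<Rightarrow> 'w \<Rightarrow> bool) \<Rightarrow> nat \<Rightarrow> 'w \<Rightarrow> nat" where
  "heads X m w = (\<Sum>i<m. of_bool (X i w))"

definition clairvoyant_payoff ::
  "(nat \<Rightarrow> 'w \<Rightarrow> bool) \<Rightarrow> nat \<Rightarrow> nat \<Rightarrow> 'w \<Rightarrow> real" where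
  "clairvoyant_payoff X a n w = (SUP m. real (a + heads X m w) / real (n + m))"

definition clairvoyant_value ::
  "'w measure \<Rightarrow> (nat \<Rightarrow> 'w \<Rightarrow> bool) \<Rightarrow> nat \<Rightarrow> nat \<Rightarrow> real" where
  "clairvoyant_value M X a n = (\<integral>w. clairvoyant_payoff X a n w \<partial>M)"

text \<open>
  For positions the real-valued supremum is over a bounded set and the Bochner integral is
  that of an integrable function, so neither takes a default value.
\<close>

lemma heads_le: "heads X m w \<le> m"
proof -
  have "heads X m w \<le> (\<Sum>i<m. 1)"
    unfolding heads_def by (rule sum_mono) simp
  then show ?thesis by simp
qed

lemma proportion_le_1:
  assumes "a \<le> n"
  shows "real (a + heads X m w) / real (n + m) \<le> 1"
proof -
  have "a + heads X m w \<le> n + m"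
    using assms heads_le[of X m w] by simp
  then show ?thesis by (cases "n + m = 0") (simp_all add: divide_le_eq_1 del: of_nat_add)
qed

lemma bdd_above_proportion:
  assumes "a \<le> n"
  shows "bdd_above (range (\<lambda>m. real (a + heads X m w) / real (n + m)))"
  using proportion_le_1[OF assms] by (intro bdd_aboveI[where M = 1]) auto

lemma (in fair_coin_tosses) integrable_clairvoyant_payoff:
  assumes "a \<le> n"
  shows "integrable M (clairvoyant_payoff X a n)"
proof (rule integrable_const_bound[where B = 1])
  have [measurable]: "X i \<in> measurable M (count_space UNIV)" for i
    using indep by (auto simp: indep_vars_def)
  have "(\<lambda>w. real (a + heads X m w) / real (n + m)) \<in> borel_measurable M" for m
    unfolding heads_def by measurable
  then show "clairvoyant_payoff X a n \<in> borel_measurable M"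
    unfolding clairvoyant_payoff_def[abs_def]
    by (intro borel_measurable_cSUP bdd_above_proportion assms) auto
  have "0 \<le> clairvoyant_payoff X a n w" for w
    unfolding clairvoyant_payoff_def
    by (rule cSUP_upper2[where x = 0, OF bdd_above_proportion[OF assms]]) auto
  moreover have "clairvoyant_payoff X a n w \<le> 1" for w
    unfolding clairvoyant_payoff_def
    by (intro cSUP_least proportion_le_1 assms) auto
  ultimately show "AE w in M. norm (clairvoyant_payoff X a n w) \<le> 1"
    by (intro AE_I2) (simp add: abs_le_iff add_increasing2)
qed

text \<open>Such a sequence of tosses exists.\<close>

lemma fair_coin_tosses_PiM:
  "fair_coin_tosses (\<Pi>\<^sub>M i\<in>(UNIV :: nat set). measure_pmf (bernoulli_pmf (1/2))) (\<lambda>i w. w i)"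
proof -
  let ?B = "measure_pmf (bernoulli_pmf (1/2))"
  interpret product_prob_space "\<lambda>_. ?B" "UNIV :: nat set"
    by standard
  let ?P = "\<Pi>\<^sub>M i\<in>(UNIV :: nat set). ?B"
  have comp: "distr ?P (count_space UNIV) (\<lambda>w. w i) = ?B" for i
  proof -
    have "distr ?P (count_space UNIV) (\<lambda>w. w i) = distr ?P ?B (\<lambda>w. w i)"
      by (rule distr_cong) simp_all
    then show ?thesis
      using PiM_component[of i] by simp
  qed
  have [measurable]: "(\<lambda>w. w i) \<in> measurable ?P (count_space UNIV)" for i
    using measurable_component_singleton[of i UNIV "\<lambda>_. ?B"] by simp
  have "P.indep_vars (\<lambda>_. count_space UNIV) (\<lambda>i w. w i) UNIV"
  proof (subst P.indep_vars_iff_distr_eq_PiM)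
    have "distr ?P (PiM UNIV (\<lambda>_. count_space UNIV)) (\<lambda>w. \<lambda>i\<in>UNIV. w i) = distr ?P ?P (\<lambda>w. w)"
      by (intro distr_cong sets_PiM_cong) auto
    then show "distr ?P (PiM UNIV (\<lambda>_. count_space UNIV)) (\<lambda>w. \<lambda>i\<in>UNIV. w i) =
        PiM UNIV (\<lambda>i. distr ?P (count_space UNIV) (\<lambda>w. w i))"
      by (simp add: comp)
  qed auto
  moreover have "measure ?P {w \<in> space ?P. w i} = 1 / 2" for i
  proof -
    have "measure ?P {w \<in> space ?P. w i} = measure (distr ?P (count_space UNIV) (\<lambda>w. w i)) {True}"
      by (subst measure_distr) (auto intro!: arg_cong[where f = "measure ?P"])
    also have "\<dots> = 1 / 2"
      by (simp add: comp measure_pmf_single)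
    finally show ?thesis .
  qed
  ultimately show ?thesis
    by unfold_locales
qed

end

theory Submission
  imports Defs "HOL-Real_Asymp.Real_Asymp"
begin

text \<open>
  For \<open>t \<ge> 0\<close>, Hoeffding's lemma makes the product of the factors
  \<open>exp (8 * t * (of_bool (X i w) - (1 / 2 + t)))\<close> a nonnegative supermartingale, so the
  maximal inequality bounds the probability that the proportion of heads ever exceeds
  \<open>1 / 2 + t\<close> by \<open>exp (- (8 * t * ((1 / 2 + t) * n - a)))\<close>. For the threshold
  \<open>max (a / n) (1 / 2) + s\<close> the exponent is \<open>- (8 * n * s\<^sup>2 + 4 * \<bar>2 * a - n\<bar> * s)\<close>;
  integrating over \<open>s \<ge> 0\<close>, keeping only the quadratic or only the linear part, gives the
  excess bounds \<open>sqrt (pi / (8 * n)) / 2\<close> and \<open>1 / (4 * \<bar>2 * a - n\<bar>)\<close>.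
\<close>

section \<open>A maximal inequality for products of independent factors\<close>

text \<open>Ville's inequality: a nonnegative supermartingale started at 1 is paid out as
  \<open>K\<close> when it first reaches \<open>K\<close>, and the expected payout cannot exceed the
  initial value.\<close>

lemma (in prob_space) prod_indep_maximal_inequality:
  fixes Y :: "nat \<Rightarrow> 'a \<Rightarrow> real"
  assumes indep: "indep_vars (\<lambda>_. borel) Y UNIV"
    and int: "\<And>i. integrable M (Y i)"
    and nonneg: "\<And>i w. 0 \<le> Y i w"
    and mean: "\<And>i. expectation (Y i) \<le> 1"
    and K: "K > 0"
  shows "prob {w \<in> space M. \<exists>m. K \<le> (\<Prod>i<m. Y i w)} \<le> 1 / K"
proof -
  have Ym [measurable]: "Y i \<in> borel_measurable M" for i
    using int by (rule borel_measurable_integrable)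
  define Z where "Z m w = (\<Prod>i<m. Y i w)" for m w
  define D where "D m w = (if \<forall>j\<le>m. Z j w < K then Z m w else 0)" for m w
  define E where "E m = {w \<in> space M. \<exists>j\<le>m. K \<le> Z j w}" for m
  have Zm [measurable]: "Z m \<in> borel_measurable M" for m
    unfolding Z_def[abs_def] by measurable
  have Dm [measurable]: "D m \<in> borel_measurable M" for m
    unfolding D_def[abs_def] by measurable
  have Em [measurable]: "E m \<in> sets M" for m
    unfolding E_def by measurable
  have Z0: "0 \<le> Z m w" for m w
    unfolding Z_def by (intro prod_nonneg) (simp add: nonneg)
  have D0: "0 \<le> D m w" for m w
    using Z0 by (simp add: D_def)
  \<comment> \<open>While not killed, \<open>Z m w < K\<close>, so killing also makes the process
    bounded.\<close>
  have Dint: "integrable M (D m)" for m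
    by (rule integrable_const_bound[where B = K]) (use Z0 K in \<open>auto simp: D_def less_imp_le\<close>)
  \<comment> \<open>\<open>D m\<close> reads only the factors with index below \<open>m\<close>, a
    block disjoint from \<open>{m}\<close>; \<open>d\<close> is \<open>D m\<close> as a function of
    that block.\<close>
  have DY: "indep_var borel (D m) borel (Y m)" for m
  proof -
    define d where "d f = (if \<forall>j\<le>m. (\<Prod>i<j. f i) < K then \<Prod>i<m. f i else 0)"
      for f :: "nat \<Rightarrow> real"
    have [measurable]: "d \<in> borel_measurable (PiM {..<m} (\<lambda>_. borel))"
    proof -
      have "(\<lambda>f. \<Prod>i<j. f i :: real) \<in> borel_measurable (PiM {..<m} (\<lambda>_. borel))"
        if "j \<le> m" for j
        using that by (intro borel_measurable_prod measurable_component_singleton) auto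
      \<comment> \<open>Capping at \<open>min j m\<close> keeps every product inside the block, so
        measurability holds for all \<open>j\<close> without a side condition.\<close>
      then have [measurable]: "(\<lambda>f. \<Prod>i<min j m. f i :: real) \<in> borel_measurable (PiM {..<m} (\<lambda>_. borel))"
        for j by simp
      have "d = (\<lambda>f. if \<forall>j\<le>m. (\<Prod>i<min j m. f i) < K then \<Prod>i<min m m. f i else 0)"
        by (auto simp: d_def fun_eq_iff min_absorb1)
      also have "\<dots> \<in> borel_measurable (PiM {..<m} (\<lambda>_. borel))"
        by measurable
      finally show ?thesis .
    qed
    have "indep_var borel (d \<circ> (\<lambda>w. restrict (\<lambda>i. Y i w) {..<m}))
                    borel ((\<lambda>f. f m) \<circ> (\<lambda>w. restrict (\<lambda>i. Y i w) {m}))"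
      by (intro indep_var_compose[OF indep_var_restrict[OF indep]]) auto
    also have "d \<circ> (\<lambda>w. restrict (\<lambda>i. Y i w) {..<m}) = D m"
      by (auto simp: fun_eq_iff d_def D_def Z_def)
    also have "(\<lambda>f. f m) \<circ> (\<lambda>w. restrict (\<lambda>i. Y i w) {m}) = Y m"
      by auto
    finally show ?thesis .
  qed
  have Eint: "integrable M (indicator (E m) :: _ \<Rightarrow> real)" for m
    by (simp add: less_top[symmetric])
  \<comment> \<open>\<open>D\<close> is the supermartingale killed when it first reaches \<open>K\<close>, so \<open>E m\<close> collects the killed mass.\<close>
  have bound: "K * prob (E m) + expectation (D m) \<le> 1" for m
  proof (induction m)
    case 0
    show ?case
    proof (cases "K \<le> 1")
      case True
      then have "E 0 = space M" "D 0 = (\<lambda>w. 0)"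
        by (auto simp: E_def D_def Z_def fun_eq_iff)
      then show ?thesis using True by (simp add: prob_space)
    next
      case False
      then have "E 0 = {}" "D 0 = (\<lambda>w. 1)"
        by (auto simp: E_def D_def Z_def fun_eq_iff)
      then show ?thesis by (simp add: prob_space)
    qed
  next
    case (Suc m)
    have DYint: "integrable M (\<lambda>w. D m w * Y m w)"
      by (rule indep_var_integrable[OF DY Dint int])
    have "K * prob (E (Suc m)) + expectation (D (Suc m))
        = expectation (\<lambda>w. K * indicator (E (Suc m)) w + D (Suc m) w)"
      using Dint Eint by (subst Bochner_Integration.integral_add) auto
    also have "\<dots> \<le> expectation (\<lambda>w. K * indicator (E m) w + D m w * Y m w)"
    proof (rule integral_mono)
      show "integrable M (\<lambda>w. K * indicator (E (Suc m)) w + D (Suc m) w)"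
        using Dint Eint by auto
      show "integrable M (\<lambda>w. K * indicator (E m) w + D m w * Y m w)"
        using DYint Eint by auto
      fix w assume w: "w \<in> space M"
      \<comment> \<open>The sides differ only at a first hit at time \<open>Suc m\<close>, where the
        payout \<open>K\<close> is at most the value \<open>Z (Suc m) w\<close> it replaces.\<close>
      show "K * indicator (E (Suc m)) w + D (Suc m) w \<le> K * indicator (E m) w + D m w * Y m w"
      proof (cases "w \<in> E m")
        case True
        then obtain j where "j \<le> m" "K \<le> Z j w"
          by (auto simp: E_def)
        then have "\<not> (\<forall>j\<le>Suc m. Z j w < K)" by (meson le_SucI not_le)
        then have "D (Suc m) w = 0"
          unfolding D_def by (rule if_not_P)
        with True show ?thesis
          using K D0[of m w] nonneg[of m w] by (auto simp: indicator_def)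
      next
        case False
        then have hit: "\<forall>j\<le>m. Z j w < K"
          using w unfolding E_def by (blast intro: not_le_imp_less)
        then have "D m w * Y m w = Z (Suc m) w"
          by (simp add: D_def Z_def)
        moreover have "w \<in> E (Suc m) \<longleftrightarrow> K \<le> Z (Suc m) w"
          using hit w by (auto simp: E_def le_Suc_eq)
        moreover have "D (Suc m) w = (if Z (Suc m) w < K then Z (Suc m) w else 0)"
          using hit by (auto simp: D_def le_Suc_eq)
        ultimately show ?thesis using False by (auto simp: indicator_def)
      qed
    qed
    also have "\<dots> = K * prob (E m) + expectation (D m) * expectation (Y m)"
      using DYint Eint indep_var_lebesgue_integral[OF DY Dint int]
      by (subst Bochner_Integration.integral_add) auto
    also have "\<dots> \<le> K * prob (E m) + expectation (D m)"
      using mean[of m] D0 by (simp add: integral_nonneg_AE mult_left_le)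
    finally show ?case using Suc.IH by linarith
  qed
  have Pm: "prob (E m) \<le> 1 / K" for m
  proof -
    have "0 \<le> expectation (D m)"
      using D0 by (simp add: integral_nonneg_AE)
    with bound[of m] show ?thesis using K by (simp add: field_simps)
  qed
  have "incseq E"
    by (auto simp: incseq_def E_def intro: order_trans)
  then have "(\<lambda>m. prob (E m)) \<longlonglongrightarrow> prob (\<Union>m. E m)"
    by (intro finite_Lim_measure_incseq) auto
  then have "prob (\<Union>m. E m) \<le> 1 / K"
    by (rule LIMSEQ_le_const2) (use Pm in auto)
  also have "(\<Union>m. E m) = {w \<in> space M. \<exists>m. K \<le> (\<Prod>i<m. Y i w)}"
    by (auto simp: E_def Z_def)
  finally show ?thesis .
qed

section \<open>Exponential tail of the clairvoyant payoff\<close>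

context fair_coin_tosses
begin

lemma measurable_toss [measurable]: "X i \<in> measurable M (count_space UNIV)"
  using indep by (auto simp: indep_vars_def)

lemma expectation_toss: "expectation (\<lambda>w. of_bool (X i w)) = (1 / 2 :: real)"
proof -
  have "expectation (\<lambda>w. of_bool (X i w)) = expectation (indicator {w \<in> space M. X i w} :: _ \<Rightarrow> real)"
    by (intro Bochner_Integration.integral_cong) (auto simp: indicator_def)
  also have "\<dots> = 1 / 2"
    using fair[of i] by (simp add: Int_absorb2 Collect_restrict)
  finally show ?thesis .
qed

text \<open>With a parameter \<lambda> in place of \<open>8 * t\<close>, Hoeffding's lemma gives the
  bound \<open>exp (\<lambda>\<^sup>2 / 8 - \<lambda> * t)\<close>. The choice \<open>8 * t\<close>
  is the largest for which this is at most 1.\<close>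

lemma expectation_exp_toss_le:
  assumes "0 \<le> (t :: real)"
  shows "expectation (\<lambda>w. exp (8 * t * (of_bool (X i w) - (1 / 2 + t)))) \<le> 1"
proof (cases "t = 0")
  case True
  then show ?thesis by (simp add: prob_space)
next
  case False
  interpret T: interval_bounded_random_variable M "\<lambda>w. of_bool (X i w)" 0 1
    by unfold_locales auto
  have "integrable M (\<lambda>w. exp (8 * t * (of_bool (X i w) - 1 / 2)))"
    by (rule integrable_const_bound[where B = "exp (8 * t)"]) (use assms in auto)
  then have "ennreal (expectation (\<lambda>w. exp (8 * t * (of_bool (X i w) - 1 / 2))))
      = (\<integral>\<^sup>+w. exp (8 * t * (of_bool (X i w) - 1 / 2)) \<partial>M)"
    by (intro nn_integral_eq_integral[symmetric]) auto
  also have "\<dots> \<le> ennreal (exp ((8 * t)\<^sup>2 / 8))"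
    using T.Hoeffdings_lemma_nn_integral[of "8 * t"] assms False
    by (simp add: expectation_toss)
  finally have *: "expectation (\<lambda>w. exp (8 * t * (of_bool (X i w) - 1 / 2))) \<le> exp (8 * t\<^sup>2)"
    by (simp add: power2_eq_square)
  have "expectation (\<lambda>w. exp (8 * t * (of_bool (X i w) - (1 / 2 + t))))
      = expectation (\<lambda>w. exp (- (8 * t\<^sup>2)) * exp (8 * t * (of_bool (X i w) - 1 / 2)))"
    by (simp add: exp_add[symmetric] algebra_simps power2_eq_square)
  also have "\<dots> \<le> exp (- (8 * t\<^sup>2)) * exp (8 * t\<^sup>2)"
    using * by simp
  finally show ?thesis by (simp add: exp_minus)
qed

lemma prob_clairvoyant_payoff_greater:
  assumes "n \<ge> 1" "a \<le> n" "0 \<le> t"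
  shows "prob {w \<in> space M. 1 / 2 + t < clairvoyant_payoff X a n w}
    \<le> exp (- (8 * t * ((1 / 2 + t) * n - a)))"
proof -
  define Y where "Y i w = exp (8 * t * (of_bool (X i w) - (1 / 2 + t)))" for i w
  \<comment> \<open>The exponent is \<open>8 * t\<close> times the lead that the future tosses must
    gain over slope \<open>1 / 2 + t\<close> to make up for the start.\<close>
  define K where "K = exp (8 * t * ((1 / 2 + t) * n - a))"
  have "prob {w \<in> space M. 1 / 2 + t < clairvoyant_payoff X a n w}
      \<le> prob {w \<in> space M. \<exists>m. K \<le> (\<Prod>i<m. Y i w)}"
  proof (rule finite_measure_mono)
    have [measurable]: "Y i \<in> borel_measurable M" for i
      unfolding Y_def[abs_def] by measurable
    show "{w \<in> space M. \<exists>m. K \<le> (\<Prod>i<m. Y i w)} \<in> events"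
      by measurable
    show "{w \<in> space M. 1 / 2 + t < clairvoyant_payoff X a n w}
        \<subseteq> {w \<in> space M. \<exists>m. K \<le> (\<Prod>i<m. Y i w)}"
    proof safe
      fix w assume "1 / 2 + t < clairvoyant_payoff X a n w"
      \<comment> \<open>Strictness yields an actual time \<open>m\<close>, even where the supremum
        is not attained.\<close>
      then have "\<exists>m. 1 / 2 + t < real (a + heads X m w) / real (n + m)"
        unfolding clairvoyant_payoff_def
        by (subst (asm) less_cSUP_iff[OF _ bdd_above_proportion[OF assms(2)]]) (blast+)
      then obtain m where "1 / 2 + t < real (a + heads X m w) / real (n + m)" ..
      then have "(1 / 2 + t) * real (n + m) \<le> a + real (heads X m w)"
        using assms(1) by (simp add: pos_less_divide_eq)
      then have "(1 / 2 + t) * n - a \<le> heads X m w - (1 / 2 + t) * m"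
        by (simp add: algebra_simps add_divide_distrib)
      then have "8 * t * ((1 / 2 + t) * n - a) \<le> 8 * t * (heads X m w - (1 / 2 + t) * m)"
        using assms(3) by (intro mult_left_mono) auto
      also have "\<dots> = (\<Sum>i<m. 8 * t * (of_bool (X i w) - (1 / 2 + t)))"
        by (simp only: sum_distrib_left[symmetric] sum_subtractf heads_def of_nat_sum)
           (simp add: mult.commute)
      finally have "K \<le> (\<Prod>i<m. Y i w)"
        by (simp add: K_def Y_def exp_sum[symmetric] del: of_nat_add)
      then show "\<exists>m. K \<le> (\<Prod>i<m. Y i w)" ..
    qed
  qed
  also have "\<dots> \<le> 1 / K"
  proof (rule prod_indep_maximal_inequality)
    show "indep_vars (\<lambda>_. borel) Y UNIV"
      unfolding Y_def by (rule indep_vars_compose2[OF indep]) simp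
    show "integrable M (Y i)" for i
      unfolding Y_def
      by (rule integrable_const_bound[where B = "exp (8 * t)"])
         (use assms(3) in \<open>auto intro!: mult_left_mono mult_left_le\<close>)
    show "expectation (Y i) \<le> 1" for i
      unfolding Y_def by (rule expectation_exp_toss_le) fact
  qed (auto simp: Y_def K_def)
  also have "1 / K = exp (- (8 * t * ((1 / 2 + t) * n - a)))"
    by (simp add: K_def exp_minus inverse_eq_divide)
  finally show ?thesis .
qed

lemma prob_clairvoyant_payoff_excess:
  assumes "n \<ge> 1" "a \<le> n" "0 \<le> s"
  shows "prob {w \<in> space M. max (a / n) (1 / 2) + s < clairvoyant_payoff X a n w}
    \<le> exp (- (8 * real n * s\<^sup>2 + 4 * \<bar>2 * real a - n\<bar> * s))"
proof -
  define t where "t = max (a / n) (1 / 2) + s - 1 / 2"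
  have t: "0 \<le> t" "1 / 2 + t = max (a / n) (1 / 2) + s"
    using add_mono[OF max.cobounded2[of "1 / 2" "a / n"] assms(3)] by (simp_all only: t_def)
  have n: "real n > 0" using assms(1) by simp
  \<comment> \<open>If \<open>2 * a \<le> n\<close>, then \<open>t = s\<close> and the linear term
    comes from the initial deficit of heads. Otherwise the required lead is \<open>n * s\<close> and
    the linear term comes from \<open>t = a / n - 1 / 2 + s\<close>.\<close>
  have "8 * t * ((1 / 2 + t) * n - a) = 8 * real n * s\<^sup>2 + 4 * \<bar>2 * real a - n\<bar> * s"
  proof (cases "2 * a \<le> n")
    case True
    then have "2 * real a \<le> n" by linarith
    moreover from this have "a / n \<le> 1 / 2" using n by (simp add: field_simps)
    ultimately show ?thesis
      by (simp add: t_def max_def power2_eq_square algebra_simps)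
  next
    case False
    then have *: "2 * real a > n" by linarith
    then have "max (a / n) (1 / 2) = a / n" using n by (simp add: field_simps max_def)
    then show ?thesis using n *
      by (simp add: t_def power2_eq_square field_simps)
  qed
  with prob_clairvoyant_payoff_greater[OF assms(1,2) t(1)] show ?thesis
    by (simp only: t(2))
qed

end

section \<open>From tail bounds to expectations\<close>

text \<open>Layer-cake formula: \<open>f - c\<close> lies below its positive part, whose expectation
  is by Tonelli the integral of the tail over \<open>s \<ge> 0\<close>.\<close>

lemma (in prob_space) integral_le_tail:
  fixes f :: "'a \<Rightarrow> real"
  assumes int: "integrable M f" and B: "0 \<le> B"
    and g: "\<And>s. 0 \<le> s \<Longrightarrow> prob {w \<in> space M. c + s < f w} \<le> g s"
    and gint: "(\<integral>\<^sup>+s. ennreal (g s) * indicator {0..} s \<partial>lborel) \<le> ennreal B"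
  shows "expectation f \<le> c + B"
proof -
  have [measurable]: "f \<in> borel_measurable M"
    using int by (rule borel_measurable_integrable)
  have "ennreal (expectation (\<lambda>w. max 0 (f w - c))) = (\<integral>\<^sup>+w. ennreal (max 0 (f w - c)) \<partial>M)"
    using int by (intro nn_integral_eq_integral[symmetric]) auto
  \<comment> \<open>The positive part becomes the length of an interval, half-open to match the
    strict tail event.\<close>
  also have "\<dots> = (\<integral>\<^sup>+w. (\<integral>\<^sup>+s. indicator {0..<max 0 (f w - c)} s \<partial>lborel) \<partial>M)"
    by simp
  also have "\<dots> = (\<integral>\<^sup>+w. (\<integral>\<^sup>+s. (if 0 \<le> s \<and> c + s < f w then 1 else 0) \<partial>lborel) \<partial>M)"
    by (intro nn_integral_cong) (auto simp: indicator_def)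
  also have "\<dots> = (\<integral>\<^sup>+s. (\<integral>\<^sup>+w. (if 0 \<le> s \<and> c + s < f w then 1 else 0) \<partial>M) \<partial>lborel)"
  proof -
    interpret pair_sigma_finite lborel M ..
    show ?thesis by (rule Fubini') measurable
  qed
  also have "\<dots> \<le> (\<integral>\<^sup>+s. ennreal (g s) * indicator {0..} s \<partial>lborel)"
  proof (rule nn_integral_mono)
    fix s :: real
    show "(\<integral>\<^sup>+w. (if 0 \<le> s \<and> c + s < f w then 1 else 0) \<partial>M) \<le> ennreal (g s) * indicator {0..} s"
    proof (cases "0 \<le> s")
      case True
      have "(\<integral>\<^sup>+w. (if 0 \<le> s \<and> c + s < f w then 1 else 0) \<partial>M)
          = (\<integral>\<^sup>+w. indicator {w \<in> space M. c + s < f w} w \<partial>M)"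
        using True by (intro nn_integral_cong) (auto simp: indicator_def)
      also have "\<dots> = ennreal (prob {w \<in> space M. c + s < f w})"
        by (simp add: emeasure_eq_measure)
      finally show ?thesis using True g[OF True] by (simp add: ennreal_leI)
    qed simp
  qed
  also note gint
  finally have "expectation (\<lambda>w. max 0 (f w - c)) \<le> B"
    using B by simp
  moreover have "expectation (\<lambda>w. f w - c) \<le> expectation (\<lambda>w. max 0 (f w - c))"
    using int by (intro integral_mono) auto
  ultimately show ?thesis
    using int by (simp add: prob_space)
qed

lemma nn_integral_exp_neg:
  assumes "0 < (k::real)"
  shows "(\<integral>\<^sup>+s. ennreal (exp (- (k * s))) * indicator {0..} s \<partial>lborel) = ennreal (1 / k)"
proof -
  have "((\<lambda>s. - exp (- (k * s)) / k) \<longlongrightarrow> 0) at_top"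
    using assms by real_asymp
  then have "(\<integral>\<^sup>+s. ennreal (exp (- (k * s))) * indicator {0..} s \<partial>lborel)
      = ennreal (0 - (- exp (- (k * 0)) / k))"
    using assms
    by (intro nn_integral_FTC_atLeast) (auto intro!: derivative_eq_intros)
  then show ?thesis by simp
qed

lemma nn_integral_exp_neg_square:
  assumes "0 < (k::real)"
  shows "(\<integral>\<^sup>+s. ennreal (exp (- (k * s\<^sup>2))) * indicator {0..} s \<partial>lborel) = ennreal (sqrt (pi / k) / 2)"
proof -
  have g: "has_bochner_integral lborel (\<lambda>x. indicator {0..} x *\<^sub>R exp (- x\<^sup>2)) (sqrt pi / 2)"
    by (rule gaussian_moment_0)
  \<comment> \<open>Substitution \<open>x = sqrt k * s\<close> in the half-line Gaussian integral;
    since \<open>sqrt k > 0\<close>, the half-line is preserved.\<close>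
  have "has_bochner_integral lborel
      (\<lambda>x. indicator {0..} (0 + sqrt k * x) *\<^sub>R exp (- (0 + sqrt k * x)\<^sup>2)) ((sqrt pi / 2) /\<^sub>R \<bar>sqrt k\<bar>)"
    by (rule lborel_has_bochner_integral_real_affine_iff[THEN iffD1, OF _ g]) (use assms in auto)
  then have "has_bochner_integral lborel (\<lambda>s. exp (- (k * s\<^sup>2)) * indicator {0..} s) (sqrt (pi / k) / 2)"
    using assms
    by (simp add: power_mult_distrib indicator_def zero_le_mult_iff real_sqrt_divide field_simps)
  then have "(\<integral>\<^sup>+s. ennreal (exp (- (k * s\<^sup>2)) * indicator {0..} s) \<partial>lborel) = ennreal (sqrt (pi / k) / 2)"
    by (subst nn_integral_eq_integral)
       (auto intro: integrable.intros simp: has_bochner_integral_integral_eq)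
  then show ?thesis
    by (simp add: ennreal_mult' ennreal_indicator)
qed

section \<open>Integrating the quadratic and the linear tail\<close>

theorem theorem3p1:
  fixes M :: "'w measure" and X :: "nat \<Rightarrow> 'w \<Rightarrow> bool" and a n :: nat
  assumes "fair_coin_tosses M X"
    and "n \<ge> 1" and "a \<le> n"
  shows "ereal (clairvoyant_value M X a n) \<le>
    ereal (max (real a / real n) (1 / 2)) +
    min (ereal (1 / 4 * sqrt (pi / real n)))
        (if 2 * a = n then \<infinity> else ereal (1 / (2 * \<bar>2 * real a - real n\<bar>)))"
proof -
  interpret fair_coin_tosses M X by fact
  let ?c = "max (real a / real n) (1 / 2)" and ?d = "\<bar>2 * real a - real n\<bar>"
  have n: "real n > 0" using assms(2) by simp
  note tail = integral_le_tail[OF integrable_clairvoyant_payoff[OF assms(3)]]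
  have "clairvoyant_value M X a n \<le> ?c + sqrt (pi / (8 * real n)) / 2"
    unfolding clairvoyant_value_def
  proof (rule tail[where g = "\<lambda>s. exp (- (8 * real n * s\<^sup>2))"])
    show "prob {w \<in> space M. ?c + s < clairvoyant_payoff X a n w} \<le> exp (- (8 * real n * s\<^sup>2))"
      if "0 \<le> s" for s
      by (rule order_trans[OF prob_clairvoyant_payoff_excess]) (use assms that in auto)
    show "(\<integral>\<^sup>+s. ennreal (exp (- (8 * real n * s\<^sup>2))) * indicator {0..} s \<partial>lborel)
        \<le> ennreal (sqrt (pi / (8 * real n)) / 2)"
      using nn_integral_exp_neg_square[of "8 * real n"] n by simp
  qed simp
  \<comment> \<open>The bound obtained is smaller than the stated Gaussian term by a factor
    \<open>sqrt 2\<close>.\<close>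
  also have "sqrt (pi / (8 * real n)) / 2 \<le> sqrt (pi / (4 * n)) / 2"
    using n by (intro divide_right_mono real_sqrt_le_mono divide_left_mono) auto
  also have "sqrt (pi / (4 * n)) / 2 = 1 / 4 * sqrt (pi / n)"
    using n by (simp add: real_sqrt_divide real_sqrt_mult)
  finally have gauss: "clairvoyant_value M X a n \<le> ?c + 1 / 4 * sqrt (pi / n)"
    by simp
  have expo: "clairvoyant_value M X a n \<le> ?c + 1 / (2 * ?d)" if "2 * a \<noteq> n"
  proof -
    \<comment> \<open>For \<open>2 * a = n\<close> the linear part vanishes and its tail bound is
      the constant 1, with infinite integral; this is the case of the value \<infinity>.\<close>
    have d: "?d > 0" using that by linarith
    have "clairvoyant_value M X a n \<le> ?c + 1 / (4 * ?d)"
      unfolding clairvoyant_value_def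
    proof (rule tail[where g = "\<lambda>s. exp (- (4 * ?d * s))"])
      show "prob {w \<in> space M. ?c + s < clairvoyant_payoff X a n w} \<le> exp (- (4 * ?d * s))"
        if "0 \<le> s" for s
        by (rule order_trans[OF prob_clairvoyant_payoff_excess]) (use assms that in auto)
      show "(\<integral>\<^sup>+s. ennreal (exp (- (4 * ?d * s))) * indicator {0..} s \<partial>lborel)
          \<le> ennreal (1 / (4 * ?d))"
        using nn_integral_exp_neg[of "4 * ?d"] d by simp
    qed simp
    \<comment> \<open>Here the slack to the stated term is a factor 2.\<close>
    also have "1 / (4 * ?d) \<le> 1 / (2 * ?d)"
      using d by (intro divide_left_mono mult_pos_pos) auto
    finally show ?thesis by simp
  qed
  show ?thesis
    using gauss expo by (simp add: min_def flip: ereal_max)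
qed

end
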